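(* Let $G$ be a finitely generated semigroup with finite generating set $G_1$, acting continuously on a compact metric space $X$. If the action is strongly $\delta^*$-expansive for some $\delta^*>0$ and the potentials $\varphi,\psi:X\to\mathbb R$ are continuous and satisfy the bounded distortion property, then: (1) $P_{top}((G,G_1),\varphi+c,X)=P_{top}((G,G_1),\varphi,X)+c$ for every $c\in\mathbb R$; (2) $|P_{top}((G,G_1),\varphi,X)-P_{top}((G,G_1),\psi,X)|\le\|\varphi-\psi\|$; (3) the pressure function $t\mapsto P_{top}((G,G_1),t\varphi,X)$, $t\in\mathbb R$, is a uniform limit of differentiable maps. Moreover, $t\mapsto P_{top}((G,G_1),t\varphi,X)$ is differentiable Lebesgue-almost everywhere.
   Context: Setting: $G$ is a semigroup with identity $id$ and finite generating set $G_1$ containing $id$; $m=|G_1\setminus\{id\}|$. A continuous action on $X$ assigns to every $g\in G$ a continuous map $g:X\to X$, with $id$ acting as the identity and products acting as compositions. $\|\cdot\|$ is the supremum norm. For a concatenation $\underline g=g_{i_n}\cdots g_{i_1}$ of elements of $G_1$ put $\underline g_0=id$, $\underline g_j=g_{i_j}\cdots g_{i_1}$; $d_{\underline g}(x,y)=\max_{0\le j\le n}d(\underline g_j(x),\underline g_j(y))$; and $S_{\underline g}\varphi(x)=\sum_{i=0}^{n-1}\varphi(\underline g_i(x))$. These depend on the concatenation, not only on the resulting element of $G$. A set $E\subset X$ is $(\underline g,n,\varepsilon)$-separated if $d_{\underline g}(x,y)>\varepsilon$ for all distinct $x,y\in E$. Topological pressure: $P_{top}((G,G_1),\varphi,X)=\lim_{\varepsilon\to0}\limsup_{n\to\infty}\frac1n\log\Big(\frac1{m^n}\sum_{\underline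 g}\sup_E\sum_{x\in E}e^{S_{\underline g}\varphi(x)}\Big)$, the sum over all $m^n$ concatenations of $n$ elements of $G_1\setminus\{id\}$ and the supremum over all $(\underline g,n,\varepsilon)$-separated sets $E$. Bounded distortion property: there exist $\varepsilon>0$ and $C>0$ such that for every concatenation $\underline g$ of generators, $\sup\{|S_{\underline g}\varphi(x)-S_{\underline g}\varphi(y)|:d_{\underline g}(x,y)<\varepsilon\}\le C$. Strongly $\delta^*$-expansive: for every $\gamma>0$ there is $k\ge1$ (depending on $\gamma$) such that for all $x,y\in X$ with $d(x,y)\ge\gamma$ one has $d_{\underline g}(x,y)>\delta^*$ for every concatenation $\underline g$ of $k$ elements of $G_1\setminus\{id\}$. *)

theory Defs
  imports "HOL-Analysis.Analysis"
begin

definition finite_generating_set :: "'g::monoid_mult set \<Rightarrow> bool" where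
  "finite_generating_set G1 \<longleftrightarrow>
     finite G1 \<and> 1 \<in> G1 \<and> (\<forall>g. \<exists>gs. set gs \<subseteq> G1 \<and> g = prod_list gs)"

definition continuous_action :: "('g::monoid_mult \<Rightarrow> 'x::topological_space \<Rightarrow> 'x) \<Rightarrow> bool" where
  "continuous_action act \<longleftrightarrow>
     act 1 = id \<and> (\<forall>g h. act (g * h) = act g \<circ> act h) \<and> (\<forall>g. continuous_on UNIV (act g))"

text \<open>
  A concatenation g(i_n) ... g(i_1) is encoded by the list [g(i_1), ..., g(i_n)] of its letters
  in the order in which they act (the rightmost letter comes first).  It is the list, not its
  product in the semigroup, on which the dynamical metric and the Birkhoff sums depend.
\<close>

definition concatenations :: "'g set \<Rightarrow> nat \<Rightarrow> 'g list set" where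
  "concatenations A n = {gs. set gs \<subseteq> A \<and> length gs = n}"

text \<open>The element g(i_j) ... g(i_1); the list is reversed since products compose from right to left.\<close>

definition partial_product :: "'g::monoid_mult list \<Rightarrow> nat \<Rightarrow> 'g" where
  "partial_product gs j = prod_list (rev (take j gs))"

definition dyn_dist :: "('g::monoid_mult \<Rightarrow> 'x::metric_space \<Rightarrow> 'x) \<Rightarrow> 'g list \<Rightarrow> 'x \<Rightarrow> 'x \<Rightarrow> real" where
  "dyn_dist act gs x y =
     (MAX j\<in>{0..length gs}. dist (act (partial_product gs j) x) (act (partial_product gs j) y))"

definition birkhoff_sum :: "('g::monoid_mult \<Rightarrow> 'x \<Rightarrow> 'x) \<Rightarrow> ('x \<Rightarrow> real) \<Rightarrow> 'g list \<Rightarrow> 'x \<Rightarrow> real" where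
  "birkhoff_sum act \<phi> gs x = (\<Sum>i<length gs. \<phi> (act (partial_product gs i) x))"

definition separated ::
  "('g::monoid_mult \<Rightarrow> 'x::metric_space \<Rightarrow> 'x) \<Rightarrow> 'g list \<Rightarrow> real \<Rightarrow> 'x set \<Rightarrow> bool" where
  "separated act gs \<epsilon> E \<longleftrightarrow> (\<forall>x\<in>E. \<forall>y\<in>E. x \<noteq> y \<longrightarrow> dyn_dist act gs x y > \<epsilon>)"

text \<open>
  For a continuous action on a nonempty compact space and \<open>\<epsilon> > 0\<close>, separated sets are finite with
  cardinality bounded in terms of the concatenation and \<open>\<epsilon>\<close>, so that the sums are
  finite sums and the real supremum is a genuine positive one.
\<close>

definition separated_sup ::
  "('g::monoid_mult \<Rightarrow> 'x::metric_space \<Rightarrow> 'x) \<Rightarrow> ('x \<Rightarrow> real) \<Rightarrow> 'g list \<Rightarrow> real \<Rightarrow> real" where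
  "separated_sup act \<phi> gs \<epsilon> =
     (SUP E\<in>{E. separated act gs \<epsilon> E}. \<Sum>x\<in>E. exp (birkhoff_sum act \<phi> gs x))"

text \<open>
  The pressure is a priori an extended real: the upper limit for fixed \<open>\<epsilon>\<close> increases as
  \<open>\<epsilon>\<close> decreases to 0, so the limit exists but need not be finite for a general action.
\<close>

definition topological_pressure ::
  "('g::monoid_mult \<Rightarrow> 'x::metric_space \<Rightarrow> 'x) \<Rightarrow> 'g set \<Rightarrow> ('x \<Rightarrow> real) \<Rightarrow> ereal" where
  "topological_pressure act G1 \<phi> =
     Lim (at_right 0) (\<lambda>\<epsilon>::real. limsup (\<lambda>n. ereal (1 / real n *
       ln (1 / real (card (G1 - {1})) ^ n *
           (\<Sum>gs\<in>concatenations (G1 - {1}) n. separated_sup act \<phi> gs \<epsilon>)))))"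

text \<open>
  The concatenations range over the nontrivial generators.  Admitting the letter 1 as well would
  include the concatenations 1 ... 1 and so force \<open>\<phi>\<close> to be locally constant; the condition below
  is implied by that stronger one.
\<close>

definition bounded_distortion ::
  "('g::monoid_mult \<Rightarrow> 'x::metric_space \<Rightarrow> 'x) \<Rightarrow> 'g set \<Rightarrow> ('x \<Rightarrow> real) \<Rightarrow> bool" where
  "bounded_distortion act G1 \<phi> \<longleftrightarrow>
     (\<exists>\<epsilon>>0. \<exists>C>0. \<forall>n. \<forall>gs\<in>concatenations (G1 - {1}) n. \<forall>x y.
        dyn_dist act gs x y < \<epsilon> \<longrightarrow>
        \<bar>birkhoff_sum act \<phi> gs x - birkhoff_sum act \<phi> gs y\<bar> \<le> C)"

definition strongly_expansive ::
  "('g::monoid_mult \<Rightarrow> 'x::metric_space \<Rightarrow> 'x) \<Rightarrow> 'g set \<Rightarrow> real \<Rightarrow> bool" where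
  "strongly_expansive act G1 \<delta> \<longleftrightarrow>
     (\<forall>\<gamma>>0. \<exists>k\<ge>1. \<forall>x y. dist x y \<ge> \<gamma> \<longrightarrow>
        (\<forall>gs\<in>concatenations (G1 - {1}) k. dyn_dist act gs x y > \<delta>))"

definition sup_norm :: "('x \<Rightarrow> real) \<Rightarrow> real" where
  "sup_norm f = (SUP x. \<bar>f x\<bar>)"

end

theory Submission
  imports Defs
begin

text \<open>
  Coding points by their itinerary through a finite cover shows that the exponential growth rate at
  every fixed scale is finite.  By strong expansiveness, a set that is separated at a scale
  \<open>\<epsilon> \<le> \<delta>\<close> along a concatenation becomes separated at scale \<open>\<delta>\<close>
  along every extension of it by \<open>k\<close> letters; hence the growth rate does not depend on
  \<open>\<epsilon> \<le> \<delta>\<close>, and the pressure is the growth rate at scale \<open>\<delta>\<close>.  Monotonicity in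
  the potential gives (1) and (2), and Hoelder's inequality gives convexity in the potential.  The
  function \<open>t \<mapsto> P(t\<phi>)\<close> is therefore convex and Lipschitz: it is the uniform limit of its
  averages over \<open>[t, t + 1/n]\<close>, which are differentiable, and it is differentiable wherever its
  monotone right derivative is continuous, that is, off a countable set.
\<close>

section \<open>Real functions\<close>

text \<open>Hoelder's inequality with weights \<open>1 - u\<close> and \<open>u\<close>: after
  dividing by the two total sums, Young's inequality holds term by term, and the normalised
  right-hand sides add up to 1.\<close>

lemma sum_powr_mult_le:
  fixes a b :: "'a \<Rightarrow> real"
  assumes fin: "finite I" and u: "0 \<le> u" "u \<le> 1"
    and pos: "\<And>i. i \<in> I \<Longrightarrow> 0 < a i" "\<And>i. i \<in> I \<Longrightarrow> 0 < b i"
  shows "(\<Sum>i\<in>I. a i powr (1 - u) * b i powr u) \<le> (\<Sum>i\<in>I. a i) powr (1 - u) * (\<Sum>i\<in>I. b i) powr u"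
proof (cases "I = {}")
  case False
  define SA where "SA = sum a I"
  define SB where "SB = sum b I"
  have S: "0 < SA" "0 < SB"
    unfolding SA_def SB_def using assms False by (auto intro!: sum_pos)
  have "a i powr (1 - u) * b i powr u
      \<le> (SA powr (1 - u) * SB powr u) * ((1 - u) * (a i / SA) + u * (b i / SB))" if i: "i \<in> I" for i
  proof -
    have "(a i / SA) powr (1 - u) * (b i / SB) powr u \<le> (1 - u) * (a i / SA) + u * (b i / SB)"
      using u pos[OF i] S by (intro Youngs_inequality_0) auto
    then have "(SA powr (1 - u) * SB powr u) * ((a i / SA) powr (1 - u) * (b i / SB) powr u)
        \<le> (SA powr (1 - u) * SB powr u) * ((1 - u) * (a i / SA) + u * (b i / SB))"
      by (intro mult_left_mono) auto
    moreover have "(SA powr (1 - u) * SB powr u) * ((a i / SA) powr (1 - u) * (b i / SB) powr u)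
        = a i powr (1 - u) * b i powr u"
      using pos[OF i] S by (simp add: powr_divide)
    ultimately show ?thesis by simp
  qed
  then have "(\<Sum>i\<in>I. a i powr (1 - u) * b i powr u)
      \<le> (\<Sum>i\<in>I. (SA powr (1 - u) * SB powr u) * ((1 - u) * (a i / SA) + u * (b i / SB)))"
    by (rule sum_mono)
  also have "\<dots> = (SA powr (1 - u) * SB powr u) * ((1 - u) * (SA / SA) + u * (SB / SB))"
    by (simp add: SA_def SB_def sum_distrib_left[symmetric] sum.distrib sum_divide_distrib[symmetric])
  also have "\<dots> = SA powr (1 - u) * SB powr u"
    using S by simp
  finally show ?thesis by (simp add: SA_def SB_def)
qed auto

text \<open>The right derivative of a convex function is monotone, hence has countably many
  discontinuities, and the function is differentiable wherever its right derivative is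
  continuous.\<close>

lemma countable_not_differentiable_convex:
  fixes p :: "real \<Rightarrow> real"
  assumes "convex_on UNIV p"
  shows "countable {t. \<not> p differentiable (at t)}"
proof -
  \<comment> \<open>The infimum of the secant slopes to the right of \<open>x\<close> is the right
    derivative. It enters only through the supporting lines \<open>sub\<close> that it
    provides.\<close>
  define D where "D x = Inf ((\<lambda>t. (p x - p t) / (x - t)) ` {x<..})" for x
  have sub: "p x + D x * (y - x) \<le> p y" for x y
    using convex_le_Inf_differential[OF assms, of x y] by (simp add: D_def)
  have "mono D"
  proof (rule monoI)
    fix x y :: real assume "x \<le> y"
    have "D x * (y - x) \<le> D y * (y - x)"
      using sub[of x y] sub[of y x] by (simp add: algebra_simps)
    then show "D x \<le> D y"
      using \<open>x \<le> y\<close> by (cases "x = y") auto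
  qed
  have "p differentiable (at x)" if "isCont D x" for x
  proof -
    \<comment> \<open>The supporting lines at \<open>x\<close> and at \<open>y\<close> trap the
      difference quotient between \<open>D x\<close> and \<open>D y\<close>, whichever side of
      \<open>x\<close> the point \<open>y\<close> is on.\<close>
    have bound: "norm ((p y - p x) / (y - x) - D x) \<le> \<bar>D y - D x\<bar>" if "y \<noteq> x" for y
    proof -
      define q where "q = (p y - p x) / (y - x)"
      have q: "p y - p x = q * (y - x)"
        using that by (simp add: q_def)
      have "D x * (y - x) \<le> q * (y - x)" "q * (y - x) \<le> D y * (y - x)"
        using sub[of x y] sub[of y x] q by (simp_all add: algebra_simps)
      then have "\<bar>q - D x\<bar> \<le> \<bar>D y - D x\<bar>"
        using that by (cases "x < y") auto
      then show ?thesis by (simp add: q_def)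
    qed
    have "((\<lambda>y. D y - D x) \<longlongrightarrow> 0) (at x)"
      using that by (simp add: isCont_def LIM_zero)
    then have "((\<lambda>y. (p y - p x) / (y - x) - D x) \<longlongrightarrow> 0) (at x)"
      by (rule Lim_null_comparison[OF _ tendsto_rabs_zero, rotated])
        (use bound in \<open>auto simp: eventually_at_filter intro!: always_eventually\<close>)
    then have "(p has_real_derivative D x) (at x)"
      by (simp add: has_field_derivative_iff LIM_zero_iff)
    then show ?thesis
      using real_differentiable_def by blast
  qed
  then have "{t. \<not> p differentiable (at t)} \<subseteq> {t. \<not> isCont D t}"
    by auto
  then show ?thesis
    using mono_ctble_discont[OF \<open>mono D\<close>] countable_subset by blast
qed

text \<open>With an antiderivative \<open>F\<close>, the mean of \<open>p\<close> over
  \<open>[t, t + 1/(n+1)]\<close> is a difference of values of \<open>F\<close>, hence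
  differentiable in \<open>t\<close>. By the mean value theorem it equals a value of
  \<open>p\<close> within \<open>1/(n+1)\<close> of \<open>t\<close>, so uniform continuity gives
  uniform convergence.\<close>

lemma uniform_limit_differentiable:
  fixes p :: "real \<Rightarrow> real"
  assumes uc: "uniformly_continuous_on UNIV p"
  shows "\<exists>f :: nat \<Rightarrow> real \<Rightarrow> real. (\<forall>n. f n differentiable_on UNIV) \<and> uniform_limit UNIV f p sequentially"
proof -
  have "isCont p x" for x
    using uniformly_continuous_imp_continuous[OF uc] by (simp add: continuous_on_eq_continuous_at)
  then obtain F where F: "\<And>x. (F has_real_derivative p x) (at x)"
    using einterval_antiderivative[of "-\<infinity>" "\<infinity>" p]
    by (auto simp: has_real_derivative_iff_has_vector_derivative)
  define f where "f n t = real (Suc n) * (F (t + 1 / real (Suc n)) - F t)" for n t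
  have diff: "f n differentiable_on UNIV" for n
  proof -
    have "(f n has_real_derivative real (Suc n) * (p (t + 1 / real (Suc n)) - p t)) (at t)" for t
      unfolding f_def
      by (auto intro!: derivative_eq_intros DERIV_chain2[OF F] F)
    then show ?thesis
      by (meson differentiable_at_imp_differentiable_on real_differentiable_def)
  qed
  have lim: "uniform_limit UNIV f p sequentially"
  proof (rule uniform_limitI)
    fix e :: real assume "e > 0"
    then obtain d where d: "d > 0" "\<And>x y. dist y x < d \<Longrightarrow> dist (p y) (p x) < e"
      using uc unfolding uniformly_continuous_on_def by (metis UNIV_I)
    obtain N where N: "inverse (real (Suc N)) < d"
      using reals_Archimedean[OF d(1)] by blast
    have "dist (f n t) (p t) < e" if "N \<le> n" for n t
    proof -
      have "inverse (real (Suc n)) \<le> inverse (real (Suc N))"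
        using that by (intro le_imp_inverse_le) auto
      then have nd: "1 / real (Suc n) < d"
        using N by (simp add: inverse_eq_divide)
      obtain z where z: "t < z" "z < t + 1 / real (Suc n)"
          "F (t + 1 / real (Suc n)) - F t = (t + 1 / real (Suc n) - t) * p z"
        using MVT2[of t "t + 1 / real (Suc n)" F p] F by auto
      have "f n t = p z"
        unfolding f_def z(3) by simp
      moreover have "dist z t < d"
        using z(1,2) nd by (simp add: dist_real_def)
      ultimately show ?thesis
        using d(2) by simp
    qed
    then show "\<forall>\<^sub>F n in sequentially. \<forall>t\<in>UNIV. dist (f n t) (p t) < e"
      by (auto simp: eventually_sequentially)
  qed
  show ?thesis
    using diff lim by blast
qed

section \<open>Concatenations\<close>

lemma finite_concatenations: "finite A \<Longrightarrow> finite (concatenations A n)"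
  unfolding concatenations_def by (rule finite_lists_length_eq)

lemma card_concatenations: "finite A \<Longrightarrow> card (concatenations A n) = card A ^ n"
  unfolding concatenations_def by (rule card_lists_length_eq)

text \<open>The factor of the later letters stands on the left, because letters act in list order
  while products compose from right to left.\<close>

lemma partial_product_add:
  "partial_product gs (j + i) = partial_product (drop j gs) i * partial_product gs j"
  by (simp add: partial_product_def take_add)

lemma partial_product_append:
  "j \<le> length gs \<Longrightarrow> partial_product (gs @ hs) j = partial_product gs j"
  by (simp add: partial_product_def)

lemma partial_product_take:
  "i \<le> k \<Longrightarrow> partial_product (take k gs) i = partial_product gs i"
  by (simp add: partial_product_def min_def)

lemma dyn_dist_greater_iff:
  "\<epsilon> < dyn_dist act gs x y \<longleftrightarrow>
    (\<exists>j\<le>length gs. \<epsilon> < dist (act (partial_product gs j) x) (act (partial_product gs j) y))"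
  unfolding dyn_dist_def by (subst Max_gr_iff) auto

lemma separated_antimono: "separated act gs \<delta> E \<Longrightarrow> \<epsilon> \<le> \<delta> \<Longrightarrow> separated act gs \<epsilon> E"
  unfolding separated_def by fastforce

lemma birkhoff_sum_le:
  assumes "\<And>x. \<phi> x \<le> \<psi> x + c"
  shows "birkhoff_sum act \<phi> gs x \<le> birkhoff_sum act \<psi> gs x + real (length gs) * c"
proof -
  have "birkhoff_sum act \<phi> gs x \<le> (\<Sum>i<length gs. \<psi> (act (partial_product gs i) x) + c)"
    unfolding birkhoff_sum_def by (intro sum_mono assms)
  then show ?thesis
    by (simp add: birkhoff_sum_def sum.distrib)
qed

lemma birkhoff_sum_linear:
  "birkhoff_sum act (\<lambda>x. a * \<phi> x + b * \<psi> x) gs x = a * birkhoff_sum act \<phi> gs x + b * birkhoff_sum act \<psi> gs x"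
  by (simp add: birkhoff_sum_def sum.distrib sum_distrib_left)

lemma abs_birkhoff_sum_le:
  assumes "\<And>x. \<bar>\<phi> x\<bar> \<le> B"
  shows "\<bar>birkhoff_sum act \<phi> gs x\<bar> \<le> real (length gs) * B"
proof -
  have "\<bar>birkhoff_sum act \<phi> gs x\<bar> \<le> (\<Sum>i<length gs. \<bar>\<phi> (act (partial_product gs i) x)\<bar>)"
    unfolding birkhoff_sum_def by (rule sum_abs)
  also have "\<dots> \<le> (\<Sum>i<length gs. B)"
    by (intro sum_mono assms)
  finally show ?thesis by simp
qed

text \<open>The first \<open>length gs\<close> terms see only prefixes of \<open>gs\<close>, and
  each of the \<open>length hs\<close> further terms is at least \<open>- B\<close>.\<close>

lemma birkhoff_sum_append_ge:
  assumes "\<And>x. \<bar>\<phi> x\<bar> \<le> B"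
  shows "birkhoff_sum act \<phi> gs x \<le> birkhoff_sum act \<phi> (gs @ hs) x + real (length hs) * B"
proof -
  let ?f = "\<lambda>i. \<phi> (act (partial_product (gs @ hs) i) x)"
  have "(\<Sum>i<length gs + n. ?f i) = (\<Sum>i<length gs. ?f i) + (\<Sum>i<n. ?f (length gs + i))" for n
    by (induction n) (simp_all add: add.assoc)
  then have "birkhoff_sum act \<phi> (gs @ hs) x
      = (\<Sum>i<length gs. ?f i) + (\<Sum>i<length hs. ?f (length gs + i))"
    by (simp add: birkhoff_sum_def)
  moreover have "(\<Sum>i<length gs. ?f i) = birkhoff_sum act \<phi> gs x"
    by (simp add: birkhoff_sum_def partial_product_append)
  moreover have "(\<Sum>i<length hs. - B) \<le> (\<Sum>i<length hs. ?f (length gs + i))"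
    using assms by (intro sum_mono) (smt (verit) abs_le_iff)
  ultimately show ?thesis by simp
qed

section \<open>Separated sets: extension of words and cardinality\<close>

text \<open>If two orbits are more than \<epsilon> apart after \<open>j\<close> letters,
  expansiveness applied to these two images makes them more than \<delta> apart during the next
  \<open>k\<close> letters. Appending \<open>k\<close> letters guarantees that so many follow even
  when \<open>j = length gs\<close>.\<close>

lemma separated_extend:
  assumes act_mult: "\<And>g h. act (g * h) = act g \<circ> act h"
    and exp: "\<And>x y w. \<epsilon> \<le> dist x y \<Longrightarrow> w \<in> concatenations A k \<Longrightarrow> \<delta> < dyn_dist act w x y"
    and sep: "separated act gs \<epsilon> E"
    and gs: "set gs \<subseteq> A" and hs: "hs \<in> concatenations A k"
  shows "separated act (gs @ hs) \<delta> E"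
  unfolding separated_def
proof (intro ballI impI)
  fix x y assume xy: "x \<in> E" "y \<in> E" "x \<noteq> y"
  then obtain j where j: "j \<le> length gs"
      "\<epsilon> < dist (act (partial_product gs j) x) (act (partial_product gs j) y)"
    using sep unfolding separated_def dyn_dist_greater_iff by blast
  \<comment> \<open>The window of \<open>k\<close> letters read from time \<open>j\<close> on; it
    may straddle the border between \<open>gs\<close> and \<open>hs\<close>.\<close>
  define w where "w = take k (drop j (gs @ hs))"
  have "set w \<subseteq> set (gs @ hs)"
    unfolding w_def using set_take_subset set_drop_subset by fast
  then have w: "w \<in> concatenations A k"
    using gs hs j(1) by (auto simp: concatenations_def w_def)
  obtain i where i: "i \<le> k"
      "\<delta> < dist (act (partial_product w i) (act (partial_product gs j) x))
               (act (partial_product w i) (act (partial_product gs j) y))"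
    using exp[OF less_imp_le[OF j(2)] w] w unfolding dyn_dist_greater_iff
    by (auto simp: concatenations_def)
  have pp: "partial_product (gs @ hs) (j + i) = partial_product w i * partial_product gs j"
    using i(1) j(1)
    by (simp add: partial_product_add partial_product_append partial_product_take w_def del: drop_append)
  have "\<delta> < dist (act (partial_product (gs @ hs) (j + i)) x) (act (partial_product (gs @ hs) (j + i)) y)"
    using i(2) by (simp only: pp act_mult o_apply)
  moreover have "j + i \<le> length (gs @ hs)"
    using i(1) j(1) hs by (simp add: concatenations_def)
  ultimately show "\<delta> < dyn_dist act (gs @ hs) x y"
    unfolding dyn_dist_greater_iff by blast
qed

text \<open>In a finite cover by balls of radius \<open>\<epsilon> / 2\<close>, distinct points of a
  separated set have distinct itineraries. Counting time 0, an itinerary has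
  \<open>Suc (length gs)\<close> entries; the base \<open>M\<close> depends neither on the word nor
  on the set.\<close>

lemma separated_card_le:
  fixes act :: "'g::monoid_mult \<Rightarrow> 'x::metric_space \<Rightarrow> 'x"
  assumes "compact (UNIV :: 'x set)" "0 < \<epsilon>"
  shows "\<exists>M\<ge>1. \<forall>gs E. separated act gs \<epsilon> E \<longrightarrow> finite E \<and> card E \<le> M ^ Suc (length gs)"
proof -
  obtain K :: "'x set" where K: "finite K" "UNIV \<subseteq> (\<Union>k\<in>K. ball k (\<epsilon> / 2))"
    using assms(1) half_gt_zero[OF assms(2)] unfolding compact_eq_totally_bounded by blast
  then have "\<forall>x. \<exists>k\<in>K. dist k x < \<epsilon> / 2"
    by (auto simp: subset_iff)
  then obtain c where c: "\<And>x. c x \<in> K" "\<And>x. dist (c x) x < \<epsilon> / 2"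
    by metis
  have "card K \<noteq> 0"
    using K(1) c(1) by auto
  moreover have "finite E \<and> card E \<le> card K ^ Suc (length gs)" if sep: "separated act gs \<epsilon> E" for gs E
  proof -
    \<comment> \<open>\<open>c\<close> chooses for each point a centre within
      \<open>\<epsilon> / 2\<close>, so equal codes force orbits that stay less than \<epsilon>
      apart.\<close>
    define code where "code x = map (\<lambda>j. c (act (partial_product gs j) x)) [0..<Suc (length gs)]" for x
    have inj: "inj_on code E"
    proof (rule inj_onI, rule ccontr)
      fix x y assume xy: "x \<in> E" "y \<in> E" "code x = code y" "x \<noteq> y"
      then obtain j where j: "j \<le> length gs"
          "\<epsilon> < dist (act (partial_product gs j) x) (act (partial_product gs j) y)"
        using sep unfolding separated_def dyn_dist_greater_iff by blast
      have "c (act (partial_product gs j) x) = c (act (partial_product gs j) y)"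
        using xy(3) j(1) unfolding code_def map_eq_conv by (simp del: upt_Suc)
      then show False
        using j(2) c(2)[of "act (partial_product gs j) x"] c(2)[of "act (partial_product gs j) y"]
        by (smt (verit) dist_commute dist_triangle2 field_sum_of_halves)
    qed
    have img: "code ` E \<subseteq> {xs. set xs \<subseteq> K \<and> length xs = Suc (length gs)}"
      using c(1) by (auto simp: code_def)
    have "finite E"
      using inj_on_finite[OF inj img] K(1) finite_lists_length_eq by blast
    moreover have "card E \<le> card K ^ Suc (length gs)"
      using card_inj_on_le[OF inj img] finite_lists_length_eq[OF K(1)]
      by (simp add: card_lists_length_eq[OF K(1)])
    ultimately show ?thesis by blast
  qed
  ultimately show ?thesis
    by (intro exI[of _ "card K"]) auto
qed

section \<open>Growth rates at a fixed scale\<close>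

text \<open>\<open>A\<close> stands for the set of nontrivial generators \<open>G1 - {1}\<close>,
  the alphabet over which the pressure averages.\<close>

locale letter_action =
  fixes act :: "'g::monoid_mult \<Rightarrow> 'x::metric_space \<Rightarrow> 'x" and A :: "'g set"
  assumes act_mult: "act (g * h) = act g \<circ> act h"
    and finite_A: "finite A" and A_nonempty: "A \<noteq> {}"
    and compact_space: "compact (UNIV :: 'x set)"
begin

definition partition_sum :: "('x \<Rightarrow> real) \<Rightarrow> real \<Rightarrow> nat \<Rightarrow> real" where
  "partition_sum \<phi> \<epsilon> n = (\<Sum>gs\<in>concatenations A n. separated_sup act \<phi> gs \<epsilon>)"

text \<open>The sequence whose upper limit enters the pressure, kept in the literal form of that
  definition. At \<open>n = 0\<close> division by zero gives the default value 0, so the estimates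
  below assume \<open>0 < n\<close>.\<close>

definition growth :: "('x \<Rightarrow> real) \<Rightarrow> real \<Rightarrow> nat \<Rightarrow> real" where
  "growth \<phi> \<epsilon> n = 1 / real n * ln (1 / real (card A) ^ n * partition_sum \<phi> \<epsilon> n)"

lemma card_A_pos: "0 < card A"
  using finite_A A_nonempty by (simp add: card_gt_0_iff)

lemma separated_singleton: "separated act gs \<epsilon> {x}"
  by (simp add: separated_def)

section \<open>Bounds for sums over separated sets\<close>

lemma separated_sum_bounded:
  assumes "0 < \<epsilon>" "\<And>x. \<bar>\<phi> x\<bar> \<le> B"
  shows "\<exists>M\<ge>1. \<forall>gs E. separated act gs \<epsilon> E \<longrightarrow>
    (\<Sum>x\<in>E. exp (birkhoff_sum act \<phi> gs x)) \<le> real M ^ Suc (length gs) * exp (real (length gs) * B)"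
proof -
  obtain M where M: "M \<ge> 1"
      "\<And>gs E. separated act gs \<epsilon> E \<Longrightarrow> finite E \<and> card E \<le> M ^ Suc (length gs)"
    using separated_card_le[OF compact_space assms(1)] by metis
  have "(\<Sum>x\<in>E. exp (birkhoff_sum act \<phi> gs x)) \<le> real M ^ Suc (length gs) * exp (real (length gs) * B)"
    if "separated act gs \<epsilon> E" for gs E
  proof -
    have "exp (birkhoff_sum act \<phi> gs x) \<le> exp (real (length gs) * B)" for x
      using abs_birkhoff_sum_le[of \<phi> B act gs x, OF assms(2)] by auto
    then have "(\<Sum>x\<in>E. exp (birkhoff_sum act \<phi> gs x)) \<le> real (card E) * exp (real (length gs) * B)"
      by (rule sum_bounded_above)
    also have "\<dots> \<le> real M ^ Suc (length gs) * exp (real (length gs) * B)"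
      using M(2)[OF that] by (intro mult_right_mono) (simp_all flip: of_nat_power del: power_Suc)
    finally show ?thesis .
  qed
  then show ?thesis using M(1) by blast
qed

text \<open>The supremum in \<open>separated_sup\<close> is taken in the reals, so this bound is
  what makes it dominate every single sum.\<close>

lemma bdd_above_separated_sums:
  assumes "0 < \<epsilon>" "bounded (range \<phi>)"
  shows "bdd_above ((\<lambda>E. \<Sum>x\<in>E. exp (birkhoff_sum act \<phi> gs x)) ` {E. separated act gs \<epsilon> E})"
proof -
  obtain B where "\<And>x. \<bar>\<phi> x\<bar> \<le> B"
    using assms(2) by (auto simp: bounded_iff)
  then obtain M where "\<And>gs E. separated act gs \<epsilon> E \<Longrightarrow>
      (\<Sum>x\<in>E. exp (birkhoff_sum act \<phi> gs x)) \<le> real M ^ Suc (length gs) * exp (real (length gs) * B)"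
    using separated_sum_bounded[of \<epsilon> \<phi> B, OF assms(1)] by metis
  then show ?thesis
    by (intro bdd_aboveI2[where M = "real M ^ Suc (length gs) * exp (real (length gs) * B)"]) blast
qed

lemma sum_le_separated_sup:
  assumes "0 < \<epsilon>" "bounded (range \<phi>)" "separated act gs \<epsilon> E"
  shows "(\<Sum>x\<in>E. exp (birkhoff_sum act \<phi> gs x)) \<le> separated_sup act \<phi> gs \<epsilon>"
  unfolding separated_sup_def
  by (rule cSUP_upper) (use assms bdd_above_separated_sums in auto)

lemma separated_sup_least:
  assumes "\<And>E. separated act gs \<epsilon> E \<Longrightarrow> (\<Sum>x\<in>E. exp (birkhoff_sum act \<phi> gs x)) \<le> b"
  shows "separated_sup act \<phi> gs \<epsilon> \<le> b"
  unfolding separated_sup_def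
  by (rule cSUP_least) (use assms separated_singleton in blast)+

lemma separated_sup_ge:
  assumes "0 < \<epsilon>" "bounded (range \<phi>)" "\<And>x. \<bar>\<phi> x\<bar> \<le> B"
  shows "exp (- (real (length gs) * B)) \<le> separated_sup act \<phi> gs \<epsilon>"
proof -
  \<comment> \<open>Types are inhabited, so there is a point \<open>x\<close>; the set
    \<open>{x}\<close> is separated and already gives the lower bound.\<close>
  fix x :: 'x
  have "exp (- (real (length gs) * B)) \<le> exp (birkhoff_sum act \<phi> gs x)"
    using abs_birkhoff_sum_le[of \<phi> B act gs x, OF assms(3)] by auto
  also have "\<dots> \<le> separated_sup act \<phi> gs \<epsilon>"
    using sum_le_separated_sup[OF assms(1,2) separated_singleton, of gs x] by simp
  finally show ?thesis .
qed

lemma separated_sup_pos: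
  assumes "0 < \<epsilon>" "bounded (range \<phi>)"
  shows "0 < separated_sup act \<phi> gs \<epsilon>"
proof -
  obtain B where "\<And>x. \<bar>\<phi> x\<bar> \<le> B"
    using assms(2) by (auto simp: bounded_iff)
  from separated_sup_ge[of \<epsilon> \<phi> B gs, OF assms this] show ?thesis
    by (rule less_le_trans[OF exp_gt_zero])
qed

lemma partition_sum_pos:
  assumes "0 < \<epsilon>" "bounded (range \<phi>)"
  shows "0 < partition_sum \<phi> \<epsilon> n"
proof -
  have "card (concatenations A n) \<noteq> 0"
    using card_A_pos by (simp add: card_concatenations[OF finite_A])
  then have "concatenations A n \<noteq> {}" by auto
  then show ?thesis
    unfolding partition_sum_def
    using assms by (intro sum_pos finite_concatenations finite_A separated_sup_pos)
qed

section \<open>Estimates for the growth sequence\<close>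

lemma growth_eq:
  assumes "0 < \<epsilon>" "bounded (range \<phi>)" "0 < n"
  shows "growth \<phi> \<epsilon> n = ln (partition_sum \<phi> \<epsilon> n) / real n - ln (real (card A))"
  using partition_sum_pos[OF assms(1,2), of n] card_A_pos assms(3)
  by (simp add: growth_def ln_mult ln_div ln_realpow field_simps)

text \<open>Birkhoff sums over \<open>n\<close> letters change by at most \<open>n * c\<close>; the
  resulting factor \<open>exp (n * c)\<close> passes through suprema and sums and becomes
  \<open>c\<close> under the normalised logarithm. The constant \<open>c\<close> may be
  negative.\<close>

lemma growth_le_add:
  assumes "0 < \<epsilon>" "bounded (range \<phi>)" "bounded (range \<psi>)" "0 < n"
    and le: "\<And>x. \<phi> x \<le> \<psi> x + c"
  shows "growth \<phi> \<epsilon> n \<le> growth \<psi> \<epsilon> n + c"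
proof -
  have "separated_sup act \<phi> gs \<epsilon> \<le> exp (real n * c) * separated_sup act \<psi> gs \<epsilon>"
    if "gs \<in> concatenations A n" for gs
  proof (rule separated_sup_least)
    fix E assume E: "separated act gs \<epsilon> E"
    have "length gs = n"
      using that by (simp add: concatenations_def)
    then have "exp (birkhoff_sum act \<phi> gs x) \<le> exp (real n * c) * exp (birkhoff_sum act \<psi> gs x)" for x
      using birkhoff_sum_le[of \<phi> \<psi> c act gs x, OF le] by (simp flip: exp_add add: add.commute)
    then have "(\<Sum>x\<in>E. exp (birkhoff_sum act \<phi> gs x))
        \<le> exp (real n * c) * (\<Sum>x\<in>E. exp (birkhoff_sum act \<psi> gs x))"
      by (simp add: sum_distrib_left sum_mono)
    also have "\<dots> \<le> exp (real n * c) * separated_sup act \<psi> gs \<epsilon>"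
      using sum_le_separated_sup[OF assms(1,3) E] by simp
    finally show "(\<Sum>x\<in>E. exp (birkhoff_sum act \<phi> gs x)) \<le> exp (real n * c) * separated_sup act \<psi> gs \<epsilon>" .
  qed
  then have "partition_sum \<phi> \<epsilon> n \<le> exp (real n * c) * partition_sum \<psi> \<epsilon> n"
    by (simp add: partition_sum_def sum_distrib_left sum_mono)
  then have "ln (partition_sum \<phi> \<epsilon> n) \<le> ln (exp (real n * c) * partition_sum \<psi> \<epsilon> n)"
    by (intro ln_mono partition_sum_pos assms(1,2))
  also have "\<dots> = real n * c + ln (partition_sum \<psi> \<epsilon> n)"
    using partition_sum_pos[OF assms(1,3), of n] by (simp add: ln_mult)
  finally show ?thesis
    using assms(4) by (simp add: growth_eq[OF assms(1,2,4)] growth_eq[OF assms(1,3,4)] field_simps)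
qed

text \<open>From above, each of the \<open>card A ^ n\<close> words contributes at most the
  itinerary count times \<open>exp (n * B)\<close>; from below, at least
  \<open>exp (- n * B)\<close> from a single point.\<close>

lemma growth_bounds:
  assumes "0 < \<epsilon>" "bounded (range \<phi>)"
  shows "\<exists>K. \<forall>n>0. \<bar>growth \<phi> \<epsilon> n\<bar> \<le> K"
proof -
  obtain B where B: "\<And>x. \<bar>\<phi> x\<bar> \<le> B"
    using assms(2) by (auto simp: bounded_iff)
  obtain M where M: "M \<ge> 1" "\<And>gs E. separated act gs \<epsilon> E \<Longrightarrow>
      (\<Sum>x\<in>E. exp (birkhoff_sum act \<phi> gs x)) \<le> real M ^ Suc (length gs) * exp (real (length gs) * B)"
    using separated_sum_bounded[of \<epsilon> \<phi> B, OF assms(1) B] by metis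
  have "\<bar>growth \<phi> \<epsilon> n\<bar> \<le> 2 * ln M + B" if n: "0 < n" for n
  proof -
    let ?m = "real (card A)"
    have len: "length gs = n" if "gs \<in> concatenations A n" for gs
      using that by (simp add: concatenations_def)
    have lnM: "0 \<le> ln (real M)"
      using M(1) by simp
    have card: "real (card (concatenations A n)) = ?m ^ n"
      by (simp add: card_concatenations[OF finite_A])
    have "partition_sum \<phi> \<epsilon> n \<le> real (card (concatenations A n)) * (real M ^ Suc n * exp (real n * B))"
      unfolding partition_sum_def
      by (rule sum_bounded_above, rule separated_sup_least) (use M(2) len in fastforce)
    then have "ln (partition_sum \<phi> \<epsilon> n) \<le> ln (?m ^ n * (real M ^ Suc n * exp (real n * B)))"
      unfolding card by (intro ln_mono partition_sum_pos assms)
    also have "\<dots> = real n * ln ?m + (real (Suc n) * ln M + real n * B)"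
      using M(1) card_A_pos by (simp add: ln_mult ln_realpow del: power_Suc of_nat_Suc)
    \<comment> \<open>Since \<open>n + 1 \<le> 2 * n\<close> for positive \<open>n\<close> and
      \<open>ln M\<close> is nonnegative, division by \<open>n\<close> leaves the constant
      \<open>2 * ln M\<close>.\<close>
    also have "\<dots> \<le> real n * ln ?m + (2 * real n * ln M + real n * B)"
      using mult_right_mono[OF _ lnM, of "real (Suc n)" "2 * real n"] n by simp
    finally have up: "ln (partition_sum \<phi> \<epsilon> n) / real n - ln ?m \<le> 2 * ln M + B"
      using n by (simp add: field_simps)
    have "real (card (concatenations A n)) * exp (- (real n * B)) \<le> partition_sum \<phi> \<epsilon> n"
      unfolding partition_sum_def
      by (rule sum_bounded_below) (use separated_sup_ge[of \<epsilon> \<phi> B, OF assms B] len in fastforce)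
    then have "ln (?m ^ n * exp (- (real n * B))) \<le> ln (partition_sum \<phi> \<epsilon> n)"
      using card_A_pos unfolding card by (intro ln_mono) auto
    moreover have "ln (?m ^ n * exp (- (real n * B))) = real n * ln ?m - real n * B"
      using card_A_pos by (simp add: ln_mult ln_realpow)
    ultimately have "- B \<le> ln (partition_sum \<phi> \<epsilon> n) / real n - ln ?m"
      using n by (simp add: field_simps)
    then show ?thesis
      using up lnM unfolding growth_eq[OF assms n] by linarith
  qed
  then show ?thesis by blast
qed

text \<open>Hoelder's inequality is used twice, first over the points of a separated set and then
  over the words; the logarithm turns the product of powers into a convex combination.\<close>

lemma growth_convex:
  assumes "0 < \<epsilon>" "bounded (range \<phi>)" "bounded (range \<psi>)" "0 < n" and u: "0 \<le> u" "u \<le> 1"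
    and bdd: "bounded (range (\<lambda>x. (1 - u) * \<phi> x + u * \<psi> x))"
  shows "growth (\<lambda>x. (1 - u) * \<phi> x + u * \<psi> x) \<epsilon> n \<le> (1 - u) * growth \<phi> \<epsilon> n + u * growth \<psi> \<epsilon> n"
proof -
  let ?\<chi> = "\<lambda>x. (1 - u) * \<phi> x + u * \<psi> x"
  let ?s = "\<lambda>\<phi> gs. separated_sup act \<phi> gs \<epsilon>"
  have "?s ?\<chi> gs \<le> ?s \<phi> gs powr (1 - u) * ?s \<psi> gs powr u" for gs
  proof (rule separated_sup_least)
    fix E assume E: "separated act gs \<epsilon> E"
    then have "finite E"
      using separated_card_le[OF compact_space assms(1)] by metis
    have "(\<Sum>x\<in>E. exp (birkhoff_sum act ?\<chi> gs x))
        = (\<Sum>x\<in>E. exp (birkhoff_sum act \<phi> gs x) powr (1 - u) * exp (birkhoff_sum act \<psi> gs x) powr u)"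
      unfolding birkhoff_sum_linear by (simp add: exp_powr_real exp_add mult.commute)
    also have "\<dots> \<le> (\<Sum>x\<in>E. exp (birkhoff_sum act \<phi> gs x)) powr (1 - u)
        * (\<Sum>x\<in>E. exp (birkhoff_sum act \<psi> gs x)) powr u"
      using \<open>finite E\<close> u by (intro sum_powr_mult_le) auto
    also have "\<dots> \<le> ?s \<phi> gs powr (1 - u) * ?s \<psi> gs powr u"
      using E assms u by (intro mult_mono powr_mono2 sum_le_separated_sup sum_nonneg) auto
    finally show "(\<Sum>x\<in>E. exp (birkhoff_sum act ?\<chi> gs x)) \<le> ?s \<phi> gs powr (1 - u) * ?s \<psi> gs powr u" .
  qed
  then have "partition_sum ?\<chi> \<epsilon> n \<le> (\<Sum>gs\<in>concatenations A n. ?s \<phi> gs powr (1 - u) * ?s \<psi> gs powr u)"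
    unfolding partition_sum_def by (rule sum_mono)
  also have "\<dots> \<le> partition_sum \<phi> \<epsilon> n powr (1 - u) * partition_sum \<psi> \<epsilon> n powr u"
    unfolding partition_sum_def
    using assms u by (intro sum_powr_mult_le finite_concatenations finite_A separated_sup_pos)
  finally have "ln (partition_sum ?\<chi> \<epsilon> n) \<le> ln (partition_sum \<phi> \<epsilon> n powr (1 - u) * partition_sum \<psi> \<epsilon> n powr u)"
    by (intro ln_mono partition_sum_pos assms(1) bdd)
  also have "\<dots> = (1 - u) * ln (partition_sum \<phi> \<epsilon> n) + u * ln (partition_sum \<psi> \<epsilon> n)"
    using partition_sum_pos[OF assms(1,2), of n] partition_sum_pos[OF assms(1,3), of n]
    by (simp add: ln_mult ln_powr)
  finally have "ln (partition_sum ?\<chi> \<epsilon> n) / real n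
      \<le> ((1 - u) * ln (partition_sum \<phi> \<epsilon> n) + u * ln (partition_sum \<psi> \<epsilon> n)) / real n"
    by (rule divide_right_mono) simp
  \<comment> \<open>The weights add up to 1, so the two normalising terms combine to a single
    \<open>ln (card A)\<close>.\<close>
  also have "\<dots> = (1 - u) * growth \<phi> \<epsilon> n + u * growth \<psi> \<epsilon> n + ln (real (card A))"
    using assms(4)
    by (simp add: growth_eq[OF assms(1,2,4)] growth_eq[OF assms(1,3,4)] field_simps)
  finally show ?thesis
    unfolding growth_eq[OF assms(1) bdd assms(4)] by linarith
qed

section \<open>Upper growth rates as real numbers\<close>

lemma limsup_growth_finite:
  assumes "0 < \<epsilon>" "bounded (range \<phi>)"
  shows "\<bar>limsup (\<lambda>n. ereal (growth \<phi> \<epsilon> n))\<bar> \<noteq> \<infinity>"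
proof -
  obtain K where K: "\<And>n. 0 < n \<Longrightarrow> \<bar>growth \<phi> \<epsilon> n\<bar> \<le> K"
    using growth_bounds[OF assms] by blast
  then have "- K \<le> growth \<phi> \<epsilon> n" "growth \<phi> \<epsilon> n \<le> K" if "0 < n" for n
    using that by (simp_all add: abs_le_iff minus_le_iff)
  then have "\<forall>\<^sub>F n in sequentially. ereal (- K) \<le> ereal (growth \<phi> \<epsilon> n)"
      "\<forall>\<^sub>F n in sequentially. ereal (growth \<phi> \<epsilon> n) \<le> ereal K"
    by (auto intro!: eventually_mono[OF eventually_gt_at_top[of 0]])
  then have "ereal (- K) \<le> limsup (\<lambda>n. ereal (growth \<phi> \<epsilon> n))"
      "limsup (\<lambda>n. ereal (growth \<phi> \<epsilon> n)) \<le> ereal K"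
    by (auto intro!: le_Limsup Limsup_bounded)
  then show ?thesis by auto
qed

text \<open>For positive \<epsilon> and bounded potentials the upper limit is finite, so
  \<open>real_of_ereal\<close> loses nothing.\<close>

definition rate :: "real \<Rightarrow> ('x \<Rightarrow> real) \<Rightarrow> real" where
  "rate \<epsilon> \<phi> = real_of_ereal (limsup (\<lambda>n. ereal (growth \<phi> \<epsilon> n)))"

lemma limsup_growth_eq:
  assumes "0 < \<epsilon>" "bounded (range \<phi>)"
  shows "limsup (\<lambda>n. ereal (growth \<phi> \<epsilon> n)) = ereal (rate \<epsilon> \<phi>)"
  using limsup_growth_finite[OF assms] by (simp add: rate_def ereal_real)

lemma eventually_growth_less:
  assumes "0 < \<epsilon>" "bounded (range \<phi>)" "rate \<epsilon> \<phi> < y"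
  shows "\<forall>\<^sub>F n in sequentially. growth \<phi> \<epsilon> n < y"
  using Limsup_lessD[of sequentially "\<lambda>n. ereal (growth \<phi> \<epsilon> n)" "ereal y"]
  by (simp add: limsup_growth_eq assms)

text \<open>Together with \<open>eventually_growth_less\<close>, this replaces calculations with
  extended-real upper limits by estimates with an error \<open>e\<close>.\<close>

lemma rate_leI:
  assumes "0 < \<epsilon>" "bounded (range \<phi>)" "\<And>e. 0 < e \<Longrightarrow> \<forall>\<^sub>F n in sequentially. growth \<phi> \<epsilon> n \<le> y + e"
  shows "rate \<epsilon> \<phi> \<le> y"
proof (rule field_le_epsilon)
  fix e :: real assume "0 < e"
  then have "limsup (\<lambda>n. ereal (growth \<phi> \<epsilon> n)) \<le> ereal (y + e)"
    using assms(3) by (intro Limsup_bounded) simp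
  then show "rate \<epsilon> \<phi> \<le> y + e"
    by (simp add: limsup_growth_eq assms)
qed

lemma rate_le_add:
  assumes "0 < \<epsilon>" "bounded (range \<phi>)" "bounded (range \<psi>)" "\<And>x. \<phi> x \<le> \<psi> x + c"
  shows "rate \<epsilon> \<phi> \<le> rate \<epsilon> \<psi> + c"
proof (rule rate_leI[OF assms(1,2)])
  fix e :: real assume "0 < e"
  then have "\<forall>\<^sub>F n in sequentially. growth \<psi> \<epsilon> n < rate \<epsilon> \<psi> + e"
    using assms by (intro eventually_growth_less) auto
  then show "\<forall>\<^sub>F n in sequentially. growth \<phi> \<epsilon> n \<le> rate \<epsilon> \<psi> + c + e"
    using eventually_gt_at_top[of 0]
  proof eventually_elim
    case (elim n)
    then show ?case
      using growth_le_add[of \<epsilon> \<phi> \<psi> n c, OF assms(1-3) _ assms(4)] by linarith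
  qed
qed

lemma rate_convex:
  assumes "0 < \<epsilon>" "bounded (range \<phi>)" "bounded (range \<psi>)" and u: "0 \<le> u" "u \<le> 1"
    and bdd: "bounded (range (\<lambda>x. (1 - u) * \<phi> x + u * \<psi> x))"
  shows "rate \<epsilon> (\<lambda>x. (1 - u) * \<phi> x + u * \<psi> x) \<le> (1 - u) * rate \<epsilon> \<phi> + u * rate \<epsilon> \<psi>"
proof (rule rate_leI[OF assms(1) bdd])
  fix e :: real assume "0 < e"
  then have "\<forall>\<^sub>F n in sequentially. growth \<phi> \<epsilon> n < rate \<epsilon> \<phi> + e"
      "\<forall>\<^sub>F n in sequentially. growth \<psi> \<epsilon> n < rate \<epsilon> \<psi> + e"
    using assms by (auto intro!: eventually_growth_less)
  then show "\<forall>\<^sub>F n in sequentially. growth (\<lambda>x. (1 - u) * \<phi> x + u * \<psi> x) \<epsilon> n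
      \<le> (1 - u) * rate \<epsilon> \<phi> + u * rate \<epsilon> \<psi> + e"
    using eventually_gt_at_top[of 0]
  proof eventually_elim
    case (elim n)
    have "growth (\<lambda>x. (1 - u) * \<phi> x + u * \<psi> x) \<epsilon> n \<le> (1 - u) * growth \<phi> \<epsilon> n + u * growth \<psi> \<epsilon> n"
      using growth_convex[OF assms(1-3) _ u bdd] elim by simp
    also have "\<dots> \<le> (1 - u) * (rate \<epsilon> \<phi> + e) + u * (rate \<epsilon> \<psi> + e)"
      using elim u by (intro add_mono mult_left_mono) auto
    also have "\<dots> = (1 - u) * rate \<epsilon> \<phi> + u * rate \<epsilon> \<psi> + e"
      by (simp add: algebra_simps)
    finally show ?case .
  qed
qed

text \<open>A smaller scale admits more separated sets, so every supremum can only grow.\<close>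

lemma rate_antimono:
  assumes "0 < \<epsilon>" "\<epsilon> \<le> \<delta>" "bounded (range \<phi>)"
  shows "rate \<delta> \<phi> \<le> rate \<epsilon> \<phi>"
proof -
  have \<delta>: "0 < \<delta>" using assms by simp
  have "growth \<phi> \<delta> n \<le> growth \<phi> \<epsilon> n" if "0 < n" for n
  proof -
    have "separated_sup act \<phi> gs \<delta> \<le> separated_sup act \<phi> gs \<epsilon>" for gs
      by (intro separated_sup_least sum_le_separated_sup assms separated_antimono[OF _ assms(2)])
    then have "partition_sum \<phi> \<delta> n \<le> partition_sum \<phi> \<epsilon> n"
      unfolding partition_sum_def by (rule sum_mono)
    then show ?thesis
      using that partition_sum_pos[OF \<delta> assms(3), of n]
      by (simp add: growth_eq[OF \<delta> assms(3) that] growth_eq[OF assms(1,3) that] divide_right_mono)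
  qed
  then have "limsup (\<lambda>n. ereal (growth \<phi> \<delta> n)) \<le> limsup (\<lambda>n. ereal (growth \<phi> \<epsilon> n))"
    by (intro Limsup_mono eventually_mono[OF eventually_gt_at_top[of 0]]) auto
  then show ?thesis
    by (simp add: limsup_growth_eq[OF \<delta> assms(3)] limsup_growth_eq[OF assms(1,3)])
qed

section \<open>Independence of the scale\<close>

text \<open>Appending one fixed word \<open>hs\<close> of length \<open>k\<close> embeds the words
  of length \<open>n\<close> into those of length \<open>n + k\<close>, and turns separation at
  scale \<epsilon> into separation at scale \<delta>. The extra letters cost a factor
  \<open>exp (k * B)\<close>; words with other endings only add positive terms.\<close>

lemma partition_sum_le_extend:
  assumes "0 < \<epsilon>" "0 < \<delta>" "bounded (range \<phi>)" "\<And>x. \<bar>\<phi> x\<bar> \<le> B"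
    and exp: "\<And>x y w. \<epsilon> \<le> dist x y \<Longrightarrow> w \<in> concatenations A k \<Longrightarrow> \<delta> < dyn_dist act w x y"
  shows "partition_sum \<phi> \<epsilon> n \<le> exp (real k * B) * partition_sum \<phi> \<delta> (n + k)"
proof -
  obtain a where "a \<in> A" using A_nonempty by blast
  define hs where "hs = replicate k a"
  have hs: "hs \<in> concatenations A k" "length hs = k"
    using \<open>a \<in> A\<close> by (auto simp: hs_def concatenations_def)
  have "separated_sup act \<phi> gs \<epsilon> \<le> exp (real k * B) * separated_sup act \<phi> (gs @ hs) \<delta>"
    if gs: "gs \<in> concatenations A n" for gs
  proof (rule separated_sup_least)
    fix E assume E: "separated act gs \<epsilon> E"
    have "separated act (gs @ hs) \<delta> E"
      using gs by (intro separated_extend[of act \<epsilon> A k \<delta> gs E hs, OF act_mult exp E _ hs(1)]) (auto simp: concatenations_def)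
    note sum_le = sum_le_separated_sup[OF assms(2,3) this]
    have "exp (birkhoff_sum act \<phi> gs x) \<le> exp (real k * B) * exp (birkhoff_sum act \<phi> (gs @ hs) x)" for x
      using birkhoff_sum_append_ge[of \<phi> B act gs x hs, OF assms(4)] hs(2)
      by (simp flip: exp_add add: add.commute)
    then have "(\<Sum>x\<in>E. exp (birkhoff_sum act \<phi> gs x))
        \<le> exp (real k * B) * (\<Sum>x\<in>E. exp (birkhoff_sum act \<phi> (gs @ hs) x))"
      by (simp add: sum_distrib_left sum_mono)
    also have "\<dots> \<le> exp (real k * B) * separated_sup act \<phi> (gs @ hs) \<delta>"
      using sum_le by simp
    finally show "(\<Sum>x\<in>E. exp (birkhoff_sum act \<phi> gs x))
        \<le> exp (real k * B) * separated_sup act \<phi> (gs @ hs) \<delta>" .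
  qed
  then have "partition_sum \<phi> \<epsilon> n
      \<le> exp (real k * B) * (\<Sum>gs\<in>concatenations A n. separated_sup act \<phi> (gs @ hs) \<delta>)"
    by (simp add: partition_sum_def sum_distrib_left sum_mono)
  also have "(\<Sum>gs\<in>concatenations A n. separated_sup act \<phi> (gs @ hs) \<delta>)
      = (\<Sum>gs\<in>(\<lambda>gs. gs @ hs) ` concatenations A n. separated_sup act \<phi> gs \<delta>)"
    by (subst sum.reindex) (auto simp: inj_on_def)
  also have "\<dots> \<le> partition_sum \<phi> \<delta> (n + k)"
    unfolding partition_sum_def
    using hs separated_sup_pos[OF assms(2,3)]
    by (intro sum_mono2 finite_concatenations finite_A) (auto simp: concatenations_def less_imp_le)
  finally show ?thesis by simp
qed

text \<open>Growth at scale \<epsilon> and length \<open>n\<close> exceeds growth at scale \<delta>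
  and length \<open>n + k\<close> by at most a term of order \<open>1 / n\<close>, which vanishes in
  the upper limit.\<close>

lemma rate_expansive:
  assumes "0 < \<epsilon>" "\<epsilon> \<le> \<delta>" "bounded (range \<phi>)"
    and exp: "\<And>x y w. \<epsilon> \<le> dist x y \<Longrightarrow> w \<in> concatenations A k \<Longrightarrow> \<delta> < dyn_dist act w x y"
  shows "rate \<epsilon> \<phi> = rate \<delta> \<phi>"
proof (rule antisym)
  have \<delta>: "0 < \<delta>" using assms by simp
  obtain B where B: "\<And>x. \<bar>\<phi> x\<bar> \<le> B"
    using assms(3) by (auto simp: bounded_iff)
  obtain K where K: "\<And>n. 0 < n \<Longrightarrow> \<bar>growth \<phi> \<delta> n\<bar> \<le> K"
    using growth_bounds[OF \<delta> assms(3)] by blast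
  \<comment> \<open>\<open>C\<close> collects the cost \<open>k * B\<close> of the extra letters and
    the surplus from replacing the factor \<open>n + k\<close> by \<open>n\<close>. The uniform
    bound \<open>K\<close> on the growth makes it independent of \<open>n\<close>.\<close>
  define C where "C = real k * (B + K + ln (real (card A)))"
  have le: "growth \<phi> \<epsilon> n \<le> growth \<phi> \<delta> (n + k) + C / real n" if n: "0 < n" for n
  proof -
    have nk: "0 < n + k" using n by simp
    have "ln (partition_sum \<phi> \<epsilon> n) \<le> ln (exp (real k * B) * partition_sum \<phi> \<delta> (n + k))"
      by (intro ln_mono partition_sum_pos assms(1,3) partition_sum_le_extend \<delta> B exp)
    also have "\<dots> = real k * B + ln (partition_sum \<phi> \<delta> (n + k))"
      using partition_sum_pos[OF \<delta> assms(3), of "n + k"] by (simp add: ln_mult)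
    also have "ln (partition_sum \<phi> \<delta> (n + k)) = real (n + k) * (growth \<phi> \<delta> (n + k) + ln (real (card A)))"
      using growth_eq[OF \<delta> assms(3) nk] nk by (simp del: of_nat_add)
    also have "real k * B + \<dots> \<le> real n * (growth \<phi> \<delta> (n + k) + ln (real (card A))) + C"
      using mult_left_mono[of "growth \<phi> \<delta> (n + k)" K "real k"] K[OF nk]
      by (simp add: C_def algebra_simps abs_le_iff)
    finally show ?thesis
      using n by (simp add: growth_eq[OF assms(1,3) n] pos_divide_le_eq algebra_simps)
  qed
  show "rate \<epsilon> \<phi> \<le> rate \<delta> \<phi>"
  proof (rule rate_leI[OF assms(1,3)])
    fix e :: real assume "0 < e"
    then have "\<forall>\<^sub>F n in sequentially. growth \<phi> \<delta> n < rate \<delta> \<phi> + e / 2"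
      using \<delta> assms(3) by (intro eventually_growth_less) auto
    then have "\<forall>\<^sub>F n in sequentially. growth \<phi> \<delta> (n + k) < rate \<delta> \<phi> + e / 2"
      by (rule sequentially_offset)
    moreover have "\<forall>\<^sub>F n in sequentially. C / real n < e / 2"
      using \<open>0 < e\<close> by (intro order_tendstoD(2)[OF lim_const_over_n]) auto
    ultimately show "\<forall>\<^sub>F n in sequentially. growth \<phi> \<epsilon> n \<le> rate \<delta> \<phi> + e"
      using eventually_gt_at_top[of 0]
    proof eventually_elim
      case (elim n)
      then show ?case using le[of n] by linarith
    qed
  qed
  show "rate \<delta> \<phi> \<le> rate \<epsilon> \<phi>"
    by (rule rate_antimono[OF assms(1-3)])
qed

end

section \<open>The pressure and its dependence on the potential\<close>

text \<open>For \<open>0 < \<epsilon> < \<delta>\<close> the upper limit does not depend on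
  \<epsilon>, so the limit at 0 is that of an eventually constant function.\<close>

lemma topological_pressure_eq_rate:
  assumes "letter_action act (G1 - {1})" "0 < \<delta>" "strongly_expansive act G1 \<delta>" "bounded (range \<phi>)"
  shows "topological_pressure act G1 \<phi> = ereal (letter_action.rate act (G1 - {1}) \<delta> \<phi>)"
proof -
  interpret letter_action act "G1 - {1}" by fact
  have "limsup (\<lambda>n. ereal (growth \<phi> \<epsilon> n)) = ereal (rate \<delta> \<phi>)" if \<epsilon>: "0 < \<epsilon>" "\<epsilon> < \<delta>" for \<epsilon>
  proof -
    \<comment> \<open>Expansiveness is used with \<epsilon> as the distance threshold;
      \<open>k\<close> varies with \<epsilon>, but the rate obtained does not.\<close>
    obtain k where "\<And>x y w. \<epsilon> \<le> dist x y \<Longrightarrow> w \<in> concatenations (G1 - {1}) k \<Longrightarrow> \<delta> < dyn_dist act w x y"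
      using assms(3) \<epsilon>(1) unfolding strongly_expansive_def by metis
    then show ?thesis
      using rate_expansive[OF \<epsilon>(1) less_imp_le[OF \<epsilon>(2)] assms(4)] limsup_growth_eq[OF \<epsilon>(1) assms(4)]
      by metis
  qed
  then have "\<forall>\<^sub>F \<epsilon> in at_right 0. limsup (\<lambda>n. ereal (growth \<phi> \<epsilon> n)) = ereal (rate \<delta> \<phi>)"
    using assms(2) unfolding eventually_at_right_field by blast
  then have "((\<lambda>\<epsilon>. limsup (\<lambda>n. ereal (growth \<phi> \<epsilon> n))) \<longlongrightarrow> ereal (rate \<delta> \<phi>)) (at_right 0)"
    by (rule tendsto_eventually)
  then show ?thesis
    unfolding topological_pressure_def growth_def partition_sum_def
    by (intro tendsto_Lim) simp
qed

theorem theorem4p6: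
  fixes act :: "'g::monoid_mult \<Rightarrow> 'x::metric_space \<Rightarrow> 'x"
    and G1 :: "'g set"
    and \<delta> :: real
    and \<phi> \<psi> :: "'x \<Rightarrow> real"
  assumes "finite_generating_set G1"
    and "G1 - {1} \<noteq> {}"
    and "compact (UNIV :: 'x set)"
    and "continuous_action act"
    and "\<delta> > 0"
    and "strongly_expansive act G1 \<delta>"
    and "continuous_on UNIV \<phi>" and "bounded_distortion act G1 \<phi>"
    and "continuous_on UNIV \<psi>" and "bounded_distortion act G1 \<psi>"
  shows "(\<forall>c::real. topological_pressure act G1 (\<lambda>x. \<phi> x + c)
                      = topological_pressure act G1 \<phi> + ereal c)
       \<and> \<bar>topological_pressure act G1 \<phi> - topological_pressure act G1 \<psi>\<bar>
             \<le> ereal (sup_norm (\<lambda>x. \<phi> x - \<psi> x))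
       \<and> (\<exists>p :: real \<Rightarrow> real.
            (\<forall>t. topological_pressure act G1 (\<lambda>x. t * \<phi> x) = ereal (p t))
          \<and> (\<exists>f :: nat \<Rightarrow> real \<Rightarrow> real.
               (\<forall>n. f n differentiable_on UNIV) \<and> uniform_limit UNIV f p sequentially)
          \<and> (AE t in lebesgue. p differentiable (at t)))"
proof -
  have la: "letter_action act (G1 - {1})"
    using assms(1-4) by unfold_locales (auto simp: finite_generating_set_def continuous_action_def)
  interpret letter_action act "G1 - {1}" by (rule la)
  have bdd: "bounded (range f)" if "continuous_on UNIV f" for f :: "'x \<Rightarrow> real"
    using compact_continuous_image[OF that assms(3)] compact_imp_bounded by blast
  \<comment> \<open>One affine family covers both the multiples of \<phi> and its
    translates.\<close>
  have bdd\<phi>: "bounded (range (\<lambda>x. a * \<phi> x + b))" for a b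
    by (intro bdd continuous_intros assms(7))
  note bdd\<phi>t = bdd\<phi>[of _ 0, simplified] and bdd\<phi>c = bdd\<phi>[of 1, simplified]
  note pressure = topological_pressure_eq_rate[OF la assms(5,6)]
  \<comment> \<open>Compactness bounds the continuous function
    \<open>\<bar>\<phi> x - \<psi> x\<bar>\<close>, so the real supremum in \<open>sup_norm\<close>
    is an upper bound.\<close>
  have abs_le: "\<bar>\<phi> x - \<psi> x\<bar> \<le> sup_norm (\<lambda>x. \<phi> x - \<psi> x)" for x
  proof -
    have "continuous_on UNIV (\<lambda>x. \<bar>\<phi> x - \<psi> x\<bar>)"
      by (intro continuous_intros assms)
    then have "bdd_above (range (\<lambda>x. \<bar>\<phi> x - \<psi> x\<bar>))"
      by (intro bounded_imp_bdd_above bdd)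
    then show ?thesis
      unfolding sup_norm_def by (rule cSUP_upper[OF UNIV_I])
  qed
  have 1: "topological_pressure act G1 (\<lambda>x. \<phi> x + c) = topological_pressure act G1 \<phi> + ereal c" for c
  proof -
    have "rate \<delta> (\<lambda>x. \<phi> x + c) \<le> rate \<delta> \<phi> + c"
      by (intro rate_le_add assms(5) bdd\<phi>c bdd assms(7)) simp
    \<comment> \<open>The reverse inequality is the same comparison with the constant
      \<open>- c\<close>.\<close>
    moreover have "rate \<delta> \<phi> \<le> rate \<delta> (\<lambda>x. \<phi> x + c) + (- c)"
      by (intro rate_le_add assms(5) bdd\<phi>c bdd assms(7)) simp
    ultimately show ?thesis
      by (simp add: pressure[OF bdd\<phi>c] pressure[OF bdd[OF assms(7)]])
  qed
  have 2: "\<bar>topological_pressure act G1 \<phi> - topological_pressure act G1 \<psi>\<bar>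
      \<le> ereal (sup_norm (\<lambda>x. \<phi> x - \<psi> x))"
  proof -
    have "\<phi> x \<le> \<psi> x + sup_norm (\<lambda>x. \<phi> x - \<psi> x)" "\<psi> x \<le> \<phi> x + sup_norm (\<lambda>x. \<phi> x - \<psi> x)" for x
      using abs_le[of x] by linarith+
    then have "rate \<delta> \<phi> \<le> rate \<delta> \<psi> + sup_norm (\<lambda>x. \<phi> x - \<psi> x)"
        "rate \<delta> \<psi> \<le> rate \<delta> \<phi> + sup_norm (\<lambda>x. \<phi> x - \<psi> x)"
      using assms(5,7,9) by (auto intro!: rate_le_add bdd)
    then show ?thesis
      using bdd[OF assms(7)] bdd[OF assms(9)] by (simp add: pressure)
  qed
  define p where "p t = rate \<delta> (\<lambda>x. t * \<phi> x)" for t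
  obtain B where B: "\<And>x. \<bar>\<phi> x\<bar> \<le> B"
    using bdd[OF assms(7)] by (auto simp: bounded_iff)
  \<comment> \<open>\<open>s * \<phi>\<close> and \<open>t * \<phi>\<close> differ by at most
    \<open>B * \<bar>s - t\<bar>\<close>; by symmetry in \<open>s\<close> and \<open>t\<close>,
    \<open>p\<close> is Lipschitz with constant \<open>B\<close>.\<close>
  have p_le: "p s \<le> p t + B * \<bar>s - t\<bar>" for s t
  proof -
    have "s * \<phi> x \<le> t * \<phi> x + B * \<bar>s - t\<bar>" for x
    proof -
      have "(s - t) * \<phi> x \<le> \<bar>s - t\<bar> * \<bar>\<phi> x\<bar>"
        by (simp flip: abs_mult)
      also have "\<dots> \<le> \<bar>s - t\<bar> * B"
        by (intro mult_left_mono B) simp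
      finally show ?thesis by (simp add: algebra_simps)
    qed
    then show ?thesis
      unfolding p_def by (intro rate_le_add assms(5) bdd\<phi>t)
  qed
  \<comment> \<open>Evaluating the bound at any one point shows that \<open>B\<close> is an
    admissible Lipschitz constant.\<close>
  have "0 \<le> B"
    using B[of undefined] by linarith
  moreover have "\<bar>p s - p t\<bar> \<le> B * \<bar>s - t\<bar>" for s t
    using p_le[of s t] p_le[of t s] by (simp add: abs_le_iff abs_minus_commute)
  ultimately have "B-lipschitz_on UNIV p"
    by (intro lipschitz_onI) (auto simp: dist_real_def)
  then have uc: "uniformly_continuous_on UNIV p"
    by (rule lipschitz_on_uniformly_continuous)
  have "convex_on UNIV p"
  proof (rule convex_onI)
    fix u s t :: real assume u: "0 < u" "u < 1"
    \<comment> \<open>The map from \<open>t\<close> to the potential \<open>t * \<phi>\<close> is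
      linear, so convexity of the rate in the potential becomes convexity of
      \<open>p\<close>.\<close>
    have eq: "(\<lambda>x. (1 - u) * (s * \<phi> x) + u * (t * \<phi> x)) = (\<lambda>x. ((1 - u) * s + u * t) * \<phi> x)"
      by (simp add: algebra_simps)
    have "rate \<delta> (\<lambda>x. (1 - u) * (s * \<phi> x) + u * (t * \<phi> x)) \<le> (1 - u) * p s + u * p t"
      unfolding p_def
      by (intro rate_convex assms(5) bdd\<phi>t less_imp_le u) (simp only: eq bdd\<phi>t)
    then show "p ((1 - u) *\<^sub>R s + u *\<^sub>R t) \<le> (1 - u) * p s + u * p t"
      unfolding eq by (simp add: p_def)
  qed auto
  \<comment> \<open>Countable sets are Lebesgue null; the almost-everywhere statement for
    \<open>lborel\<close> then passes to its completion.\<close>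
  then have "{t. \<not> p differentiable (at t)} \<in> null_sets lborel"
    by (intro countable_imp_null_set_lborel countable_not_differentiable_convex)
  then have "AE t in lborel. p differentiable (at t)"
    by (rule AE_I') auto
  then have "AE t in lebesgue. p differentiable (at t)"
    by (rule AE_completion)
  moreover have "topological_pressure act G1 (\<lambda>x. t * \<phi> x) = ereal (p t)" for t
    unfolding p_def by (rule pressure[OF bdd\<phi>t])
  ultimately show ?thesis
    using 1 2 uniform_limit_differentiable[OF uc] by blast
qed

end
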